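(* For every quantum score $S$ on $\mathcal X$ there exists a projective quantum score $S'$ with $S'(\rho';\rho)=S(\rho';\rho)$ for all $\rho,\rho'\in\mathrm{Dens}(\mathcal X)$.
   Context: Let $\mathcal X=\mathbb C^n$, $\mathrm{Herm}(\mathcal X)$ the Hermitian matrices with $\langle X,Y\rangle=\mathrm{Tr}(X^*Y)$, $\mathrm{Pos}(\mathcal X)$ the positive semidefinite ones, $\mathrm{Dens}(\mathcal X)$ the trace-one elements of $\mathrm{Pos}(\mathcal X)$. A measurement with finite outcome set $\mathcal Y\subseteq\mathbb N$ is $\mu=\{\mu_y\}_{y\in\mathcal Y}\subseteq\mathrm{Pos}(\mathcal X)$ with $\sum_y\mu_y=I$; it is projection-valued (a PVM) if the $\mu_y$ are mutually orthogonal orthogonal projections. A quantum score is $S=(s,\mu)$ with $s:\mathrm{Dens}(\mathcal X)\times\mathbb N\to\mathbb R\cup\{\pm\infty\}$, $\mu:\mathrm{Dens}(\mathcal X)\to\mathrm{Meas}(\mathcal X)$ (outcome set $\mathcal Y(\rho')$), expected score $S(\rho';\rho)=\sum_{y\in\mathcal Y(\rho')}\langle\mu(\rho')_y,\rho\rangle s(\rho',y)$, with conventions $0\cdot(\pm\infty)=0$ and $c\cdot(-\infty)=-\infty$ for $c>0$, and assumed well defined (no $\infty-\infty$). $S$ is projective if $\mu(\rho)$ is a PVM for every $\rho$. *)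

theory Defs
  imports "HOL-Analysis.Analysis" "HOL-Library.Extended_Real"
begin

text \<open>Matrices on X = C^n are represented as complex^'n::finite^'n for a finite index type 'n.\<close>

definition cadj :: "complex^'n::finite^'n \<Rightarrow> complex^'n::finite^'n" where
  "cadj A = (\<chi> i j. cnj (A $ j $ i))"

definition ctrace :: "complex^'n::finite^'n \<Rightarrow> complex" where
  "ctrace A = (\<Sum>i\<in>UNIV. A $ i $ i)"

text \<open>Hilbert-Schmidt inner product Tr(X^* Y).\<close>
definition hs_inner :: "complex^'n::finite^'n \<Rightarrow> complex^'n::finite^'n \<Rightarrow> complex" where
  "hs_inner X Y = ctrace (cadj X ** Y)"

definition herm :: "complex^'n::finite^'n \<Rightarrow> bool" where
  "herm A \<longleftrightarrow> cadj A = A"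

definition pos :: "complex^'n::finite^'n \<Rightarrow> bool" where
  "pos A \<longleftrightarrow> herm A \<and> (\<forall>v::complex^'n::finite. 0 \<le> Re (\<Sum>i\<in>UNIV. cnj (v $ i) * (A *v v) $ i))"

definition dens :: "complex^'n::finite^'n \<Rightarrow> bool" where
  "dens \<rho> \<longleftrightarrow> pos \<rho> \<and> ctrace \<rho> = 1"

text \<open>A measurement: finite outcome set Y of naturals and effects m y, y in Y.\<close>
definition is_measurement :: "nat set \<Rightarrow> (nat \<Rightarrow> complex^'n::finite^'n) \<Rightarrow> bool" where
  "is_measurement Y m \<longleftrightarrow> finite Y \<and> (\<forall>y\<in>Y. pos (m y)) \<and> (\<Sum>y\<in>Y. m y) = mat 1"

definition is_pvm :: "nat set \<Rightarrow> (nat \<Rightarrow> complex^'n::finite^'n) \<Rightarrow> bool" where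
  "is_pvm Y m \<longleftrightarrow> is_measurement Y m \<and>
     (\<forall>y\<in>Y. m y ** m y = m y \<and> cadj (m y) = m y) \<and>
     (\<forall>y\<in>Y. \<forall>z\<in>Y. y \<noteq> z \<longrightarrow> m y ** m z = 0)"

type_synonym ('n) qscore =
  "(complex^'n::finite^'n \<Rightarrow> nat \<Rightarrow> ereal) \<times> (complex^'n::finite^'n \<Rightarrow> nat set \<times> (nat \<Rightarrow> complex^'n::finite^'n))"

text \<open>Summand <mu(rho')_y, rho> s(rho', y); ereal multiplication already has 0*(+-inf)=0
  and c*(-inf) = -inf for c>0.\<close>
definition score_term :: "'n::finite qscore \<Rightarrow> complex^'n::finite^'n \<Rightarrow> complex^'n::finite^'n \<Rightarrow> nat \<Rightarrow> ereal" where
  "score_term S \<rho>' \<rho> y = ereal (Re (hs_inner (snd (snd S \<rho>') y) \<rho>)) * fst S \<rho>' y"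

definition expected_score :: "'n::finite qscore \<Rightarrow> complex^'n::finite^'n \<Rightarrow> complex^'n::finite^'n \<Rightarrow> ereal" where
  "expected_score S \<rho>' \<rho> = (\<Sum>y\<in>fst (snd S \<rho>'). score_term S \<rho>' \<rho> y)"

text \<open>Well-definedness: no sum of the form infinity minus infinity.\<close>
definition score_well_defined :: "'n::finite qscore \<Rightarrow> bool" where
  "score_well_defined S \<longleftrightarrow> (\<forall>\<rho>' \<rho>. dens \<rho>' \<longrightarrow> dens \<rho> \<longrightarrow>
     \<not> ((\<exists>y\<in>fst (snd S \<rho>'). score_term S \<rho>' \<rho> y = \<infinity>) \<and>
        (\<exists>y\<in>fst (snd S \<rho>'). score_term S \<rho>' \<rho> y = -\<infinity>)))"

definition quantum_score :: "'n::finite qscore \<Rightarrow> bool" where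
  "quantum_score S \<longleftrightarrow> (\<forall>\<rho>. dens \<rho> \<longrightarrow> is_measurement (fst (snd S \<rho>)) (snd (snd S \<rho>)))
     \<and> score_well_defined S"

definition projective :: "'n::finite qscore \<Rightarrow> bool" where
  "projective S \<longleftrightarrow> (\<forall>\<rho>. dens \<rho> \<longrightarrow> is_pvm (fst (snd S \<rho>)) (snd (snd S \<rho>)))"

end

theory Submission
  imports Defs
begin

text \<open>The projective score is built separately for each prediction \<rho>'. Given its measurement
  \<mu> with scores s, the nonzero effects carrying an infinite score all carry the same one, \<sigma>,
  because at the maximally mixed state they all have positive weight. Let P be the support
  projection of the sum of these effects and C the sum of the finite scores times their effects.
  The new PVM consists of P, scored \<sigma>, and the spectral projections of (1 - P) C (1 - P),
  scored by their eigenvalues. A state with positive weight on P gives positive weight to an effect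
  with infinite score, so both expected scores are \<sigma>; a state annihilated by P is fixed by
  compression with 1 - P, so both expected scores are tr(C \<rho>).\<close>

lemma sum_fun_upd_insert:
  assumes "finite K" "k \<notin> K"
  shows "sum (f(k := x)) (insert k K) = x + sum f K"
proof -
  have "sum (f(k := x)) K = sum f K"
    using assms(2) by (intro sum.cong) auto
  then show ?thesis
    using assms by (simp add: sum.insert_remove)
qed

section \<open>Adjoints, traces and Hermitian forms\<close>

type_synonym 'n cmat = "complex^'n^'n"

lemma matrix_add_rdistrib: "(A + B) ** C = A ** C + B ** (C :: 'a::semiring_1^_^_)"
  by (simp add: vec_eq_iff matrix_matrix_mult_def distrib_right sum.distrib)

lemma matrix_diff_ldistrib: "A ** (B - C) = A ** B - A ** (C :: 'a::ring_1^_^_)"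
  by (simp add: vec_eq_iff matrix_matrix_mult_def right_diff_distrib sum_subtractf)

lemma matrix_diff_rdistrib: "(A - B) ** C = A ** C - B ** (C :: 'a::ring_1^_^_)"
  by (simp add: vec_eq_iff matrix_matrix_mult_def left_diff_distrib sum_subtractf)

lemma matrix_sum_ldistrib: "A ** sum f K = (\<Sum>k\<in>K. A ** (f k :: 'a::semiring_1^_^_))"
  by (induction K rule: infinite_finite_induct) (auto simp: matrix_add_ldistrib)

lemma matrix_sum_rdistrib: "sum f K ** B = (\<Sum>k\<in>K. f k ** (B :: 'a::semiring_1^_^_))"
  by (induction K rule: infinite_finite_induct) (auto simp: matrix_add_rdistrib)

lemma matrix_mul_scaleR_right: "A ** (r *\<^sub>R B) = r *\<^sub>R (A ** (B :: 'a::real_algebra_1^_^_))"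
  by (simp add: matrix_scalar_ac scalar_matrix_assoc)

lemma matrix_vector_scaleR: "A *v (r *\<^sub>R v) = r *\<^sub>R (A *v (v :: 'a::real_algebra_1^_))"
  by (simp add: linear_cmul)

lemma scaleR_matrix_vector: "(r *\<^sub>R A) *v v = r *\<^sub>R (A *v (v :: 'a::real_algebra_1^_))"
  by (simp add: vec_eq_iff matrix_vector_mult_def scaleR_sum_right)

lemma cadj_nth [simp]: "cadj A $ i $ j = cnj (A $ j $ i)"
  by (simp add: cadj_def)

lemma cadj_cadj [simp]: "cadj (cadj A) = A"
  by (simp add: vec_eq_iff)

lemma cadj_mult: "cadj (A ** B) = cadj B ** cadj A"
  by (simp add: vec_eq_iff matrix_matrix_mult_def mult.commute)

lemma cadj_zero [simp]: "cadj 0 = 0"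
  by (simp add: vec_eq_iff)

lemma cadj_add: "cadj (A + B) = cadj A + cadj B"
  by (simp add: vec_eq_iff)

lemma cadj_diff: "cadj (A - B) = cadj A - cadj B"
  by (simp add: vec_eq_iff)

lemma cadj_mat [simp]: "cadj (mat 1) = mat 1"
  by (simp add: vec_eq_iff mat_def)

lemma cadj_scaleR: "cadj (r *\<^sub>R A) = r *\<^sub>R cadj A"
  by (simp add: vec_eq_iff scaleR_conv_of_real[where 'a = complex])

lemma cadj_sum: "cadj (sum f K) = (\<Sum>k\<in>K. cadj (f k))"
  by (induction K rule: infinite_finite_induct) (auto simp: vec_eq_iff)

lemma herm_mult_flip: "herm A \<Longrightarrow> herm B \<Longrightarrow> A ** B = C \<Longrightarrow> B ** A = cadj C"
  by (metis cadj_mult herm_def)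

lemma ctrace_scaleR: "ctrace (r *\<^sub>R A) = of_real r * ctrace A"
  by (simp add: ctrace_def scaleR_conv_of_real[where 'a = complex] sum_distrib_left)

lemma ctrace_sum: "ctrace (sum f K) = (\<Sum>k\<in>K. ctrace (f k))"
  by (induction K rule: infinite_finite_induct) (auto simp: ctrace_def sum.distrib)

lemma ctrace_mat: "ctrace (mat 1 :: 'n::finite cmat) = of_nat CARD('n)"
  by (simp add: ctrace_def mat_def)

lemma ctrace_commute: "ctrace (A ** B) = ctrace (B ** A)"
  unfolding ctrace_def matrix_matrix_mult_def
  by (simp add: mult.commute) (rule sum.swap)

lemma hs_inner_compression:
  assumes "herm Z" "Z ** \<rho> = \<rho>" "\<rho> ** Z = \<rho>"
  shows "hs_inner (Z ** C ** Z) \<rho> = hs_inner C \<rho>"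
proof -
  have "hs_inner (Z ** C ** Z) \<rho> = ctrace (Z ** (cadj C ** \<rho>))"
    using assms by (simp add: hs_inner_def cadj_mult herm_def matrix_mul_assoc[symmetric])
  also have "\<dots> = ctrace (cadj C ** \<rho>)"
    using assms(3) by (simp add: ctrace_commute[of Z] matrix_mul_assoc[symmetric])
  finally show ?thesis
    by (simp add: hs_inner_def)
qed

lemma hs_inner_herm: "herm X \<Longrightarrow> hs_inner X \<rho> = ctrace (X ** \<rho>)"
  by (simp add: hs_inner_def herm_def)

lemma hs_inner_sum_left: "hs_inner (sum f K) \<rho> = (\<Sum>k\<in>K. hs_inner (f k) \<rho>)"
  by (simp add: hs_inner_def cadj_sum matrix_sum_rdistrib ctrace_sum)

lemma hs_inner_scaleR_left: "hs_inner (r *\<^sub>R X) \<rho> = of_real r * hs_inner X \<rho>"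
  by (simp add: hs_inner_def cadj_scaleR scalar_matrix_assoc[symmetric] ctrace_scaleR)

definition cinner :: "complex^'n::finite \<Rightarrow> complex^'n \<Rightarrow> complex" where
  "cinner u v = (\<Sum>i\<in>UNIV. cnj (u $ i) * v $ i)"

lemma inner_eq_Re_cinner: "u \<bullet> v = Re (cinner u v)"
  by (simp add: inner_vec_def cinner_def inner_complex_def)

lemma cinner_commute: "cinner u v = cnj (cinner v u)"
  by (simp add: cinner_def mult.commute)

lemma cinner_self: "cinner u u = of_real ((norm u)\<^sup>2)"
proof -
  have "cinner u u = (\<Sum>i\<in>UNIV. of_real ((cmod (u $ i))\<^sup>2))"
    unfolding cinner_def
    by (intro sum.cong refl) (metis complex_norm_square mult.commute of_real_power)
  also have "\<dots> = of_real ((norm u)\<^sup>2)"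
    by (simp add: norm_vec_def L2_set_def sum_nonneg)
  finally show ?thesis .
qed

lemma cinner_matrix_left: "cinner (A *v u) v = cinner u (cadj A *v v)"
  unfolding cinner_def matrix_vector_mult_def
  by (simp add: sum_distrib_left sum_distrib_right mult_ac) (rule sum.swap)

lemma herm_inner_commute: "herm B \<Longrightarrow> y \<bullet> (B *v x) = x \<bullet> (B *v y)"
proof -
  assume "herm B"
  then have "cinner y (B *v x) = cnj (cinner x (B *v y))"
    by (metis cinner_commute cinner_matrix_left herm_def)
  then show ?thesis
    by (simp add: inner_eq_Re_cinner)
qed

lemma pos_iff_inner: "pos X \<longleftrightarrow> herm X \<and> (\<forall>v. 0 \<le> v \<bullet> (X *v v))"
  by (simp add: pos_def inner_eq_Re_cinner cinner_def)

text \<open>Otherwise the form would be negative at x - t Bx for small t > 0.\<close>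
lemma herm_psd_form_zero_imp_kernel:
  assumes "herm B" and V: "subspace V" and psd: "\<forall>v\<in>V. 0 \<le> v \<bullet> (B *v v)"
    and x: "x \<in> V" "B *v x \<in> V" and x0: "x \<bullet> (B *v x) = 0"
  shows "B *v x = 0"
proof -
  define y where "y = B *v x"
  define a where "a = y \<bullet> y"
  define b where "b = y \<bullet> (B *v y)"
  have b0: "0 \<le> b"
    using psd x by (simp add: b_def y_def)
  have quadratic: "0 \<le> 2 * t * a + t\<^sup>2 * b" for t :: real
  proof -
    have "x + t *\<^sub>R y \<in> V"
      using V x by (simp add: y_def subspace_add subspace_scale)
    then have "0 \<le> (x + t *\<^sub>R y) \<bullet> (B *v (x + t *\<^sub>R y))"
      using psd by blast
    also have "\<dots> = x \<bullet> (B *v x) + t * (x \<bullet> (B *v y)) + t * (y \<bullet> (B *v x)) + t\<^sup>2 * b"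
      by (simp add: matrix_vector_scaleR b_def power2_eq_square algebra_simps)
    also have "x \<bullet> (B *v y) = y \<bullet> (B *v x)"
      using herm_inner_commute[OF \<open>herm B\<close>] by simp
    finally show ?thesis
      using x0 by (simp add: a_def y_def algebra_simps)
  qed
  have "a = 0"
  proof (rule ccontr)
    assume "a \<noteq> 0"
    then have "a > 0"
      by (simp add: a_def)
    have "0 \<le> 2 * (- a / (b + 1)) * a + (- a / (b + 1))\<^sup>2 * b"
      by (rule quadratic)
    also have "\<dots> = a\<^sup>2 * (- b - 2) / (b + 1)\<^sup>2"
      using b0 by (simp add: power2_eq_square divide_simps) (simp add: algebra_simps)
    also have "\<dots> < 0"
      using \<open>a > 0\<close> b0 by (intro divide_neg_pos mult_pos_neg) auto
    finally show False
      by simp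
  qed
  then show ?thesis
    by (simp add: a_def y_def)
qed

section \<open>Orthogonal projections\<close>

definition orth_proj :: "'n::finite cmat \<Rightarrow> bool" where
  "orth_proj P \<longleftrightarrow> cadj P = P \<and> P ** P = P"

definition orth_projs :: "nat set \<Rightarrow> (nat \<Rightarrow> 'n::finite cmat) \<Rightarrow> bool" where
  "orth_projs K P \<longleftrightarrow> finite K \<and> (\<forall>k\<in>K. orth_proj (P k)) \<and>
     (\<forall>k\<in>K. \<forall>l\<in>K. k \<noteq> l \<longrightarrow> P k ** P l = 0)"

lemma orth_proj_herm: "orth_proj P \<Longrightarrow> herm P"
  by (simp add: orth_proj_def herm_def)

lemma orth_proj_pos: "orth_proj P \<Longrightarrow> pos P"
proof -
  assume P: "orth_proj P"
  have "v \<bullet> (P *v v) = (P *v v) \<bullet> (P *v v)" for v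
  proof -
    have "v \<bullet> (P *v v) = v \<bullet> (P *v (P *v v))"
      using P by (simp add: orth_proj_def matrix_vector_mul_assoc)
    also have "\<dots> = (P *v v) \<bullet> (P *v v)"
      by (rule herm_inner_commute[OF orth_proj_herm[OF P]])
    finally show ?thesis .
  qed
  then show ?thesis
    using P by (simp add: pos_iff_inner orth_proj_herm)
qed

lemma orth_proj_mat: "orth_proj (mat 1)"
  by (simp add: orth_proj_def)

lemma orth_proj_diff:
  assumes "orth_proj Q" "orth_proj R" "Q ** R = R"
  shows "orth_proj (Q - R)"
proof -
  have "R ** Q = R"
    using herm_mult_flip[of Q R R] assms by (simp add: orth_proj_herm orth_proj_def)
  then show ?thesis
    using assms by (simp add: orth_proj_def cadj_diff matrix_diff_ldistrib matrix_diff_rdistrib)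
qed

lemma orth_projs_mult_sum:
  assumes "orth_projs K P" "k \<in> K"
  shows "P k ** sum P K = P k"
proof -
  have "P k ** sum P K = (\<Sum>l\<in>K. P k ** P l)"
    by (rule matrix_sum_ldistrib)
  also have "\<dots> = P k ** P k + (\<Sum>l\<in>K - {k}. P k ** P l)"
    using assms by (simp add: orth_projs_def sum.remove)
  also have "(\<Sum>l\<in>K - {k}. P k ** P l) = 0"
    using assms by (intro sum.neutral) (auto simp: orth_projs_def)
  finally show ?thesis
    using assms by (simp add: orth_projs_def orth_proj_def)
qed

lemma orth_projs_sum: "orth_projs K P \<Longrightarrow> orth_proj (sum P K)"
  by (simp add: orth_proj_def orth_projs_def cadj_sum matrix_sum_rdistrib orth_projs_mult_sum)

lemma orth_projs_weighted_sum_mult: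
  assumes "orth_projs K P" "k \<in> K"
  shows "(\<Sum>l\<in>K. f l *\<^sub>R P l) ** P k = f k *\<^sub>R P k"
proof -
  have "(\<Sum>l\<in>K. f l *\<^sub>R P l) ** P k = (\<Sum>l\<in>K. f l *\<^sub>R (P l ** P k))"
    by (simp add: matrix_sum_rdistrib scalar_matrix_assoc)
  also have "\<dots> = f k *\<^sub>R (P k ** P k) + (\<Sum>l\<in>K - {k}. f l *\<^sub>R (P l ** P k))"
    using assms by (simp add: orth_projs_def sum.remove)
  also have "(\<Sum>l\<in>K - {k}. f l *\<^sub>R (P l ** P k)) = 0"
    using assms by (intro sum.neutral) (auto simp: orth_projs_def)
  finally show ?thesis
    using assms by (simp add: orth_projs_def orth_proj_def)
qed

lemma orth_projs_insert:
  assumes P: "orth_projs K P" and "k0 \<notin> K" and R: "orth_proj R" and "sum P K ** R = 0"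
  shows "orth_projs (insert k0 K) (P(k0 := R))"
proof -
  have PR: "P k ** R = 0" if "k \<in> K" for k
  proof -
    have "P k ** R = P k ** (sum P K ** R)"
      using orth_projs_mult_sum[OF P that] by (simp add: matrix_mul_assoc)
    then show ?thesis
      using assms by simp
  qed
  have "R ** P k = 0" if "k \<in> K" for k
    using herm_mult_flip[OF _ _ PR[OF that]] P R that
    by (simp add: orth_projs_def orth_proj_herm)
  then show ?thesis
    using assms PR by (auto simp: orth_projs_def)
qed

lemma pvm_iff_orth_projs: "is_pvm Y m \<longleftrightarrow> orth_projs Y m \<and> sum m Y = mat 1"
  by (auto simp: is_pvm_def is_measurement_def orth_projs_def orth_proj_def
      intro: orth_proj_pos[unfolded orth_proj_def])

definition rank_one :: "complex^'n::finite \<Rightarrow> 'n cmat" where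
  "rank_one u = (\<chi> i j. u $ i * cnj (u $ j))"

lemma matrix_rank_one: "X ** rank_one u = (\<chi> i j. (X *v u) $ i * cnj (u $ j))"
  by (simp add: vec_eq_iff rank_one_def matrix_matrix_mult_def matrix_vector_mult_def
      sum_distrib_left sum_distrib_right mult_ac)

lemma rank_one_vector: "rank_one u *v v = cinner u v *s u"
  by (simp add: vec_eq_iff rank_one_def cinner_def matrix_vector_mult_def sum_distrib_left mult_ac)

lemma orth_proj_rank_one: "norm u = 1 \<Longrightarrow> orth_proj (rank_one u)"
  by (simp add: orth_proj_def vec_eq_iff matrix_rank_one rank_one_vector cinner_self)
    (simp add: rank_one_def mult.commute)

lemma rank_one_unit_vector: "norm u = 1 \<Longrightarrow> rank_one u *v u = u"
  by (simp add: rank_one_vector cinner_self)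

lemma eigenvector_rank_one: "X *v u = c *\<^sub>R u \<Longrightarrow> X ** rank_one u = c *\<^sub>R rank_one u"
  unfolding matrix_rank_one by (simp add: rank_one_def vec_eq_iff scaleR_conv_of_real[where 'a = complex])

section \<open>The spectral theorem\<close>

lemma rayleigh_maximizer_exists:
  fixes A :: "'n::finite cmat"
  assumes V: "subspace V" and "V \<noteq> {0}"
  obtains u where "u \<in> V" "norm u = 1" "\<And>y. y \<in> V \<Longrightarrow> norm y = 1 \<Longrightarrow> y \<bullet> (A *v y) \<le> u \<bullet> (A *v u)"
proof -
  define K where "K = sphere 0 1 \<inter> V"
  have "compact K"
    unfolding K_def using closed_subspace[OF V] by (intro compact_Int_closed) auto
  obtain v where "v \<in> V" "v \<noteq> 0"
    using assms subspace_0 by blast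
  then have "(1 / norm v) *\<^sub>R v \<in> K"
    using V by (simp add: K_def subspace_scale)
  then have "K \<noteq> {}"
    by blast
  moreover have "continuous_on K (\<lambda>x. x \<bullet> (A *v x))"
    by (intro continuous_intros linear_continuous_on linear_conv_bounded_linear[THEN iffD1]) auto
  ultimately obtain u where "u \<in> K" "\<forall>y\<in>K. y \<bullet> (A *v y) \<le> u \<bullet> (A *v u)"
    using continuous_attains_sup[OF \<open>compact K\<close>] by blast
  then show ?thesis
    by (intro that) (auto simp: K_def)
qed

text \<open>The maximum M of the Rayleigh quotient on V makes M - A positive semidefinite on V, and the
  maximizer is a zero of its form.\<close>
lemma rayleigh_maximizer_eigenvector:
  fixes A :: "'n::finite cmat"
  assumes "herm A" and V: "subspace V" and inv: "\<And>x. x \<in> V \<Longrightarrow> A *v x \<in> V"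
    and u: "u \<in> V" "norm u = 1"
    and max: "\<And>y. y \<in> V \<Longrightarrow> norm y = 1 \<Longrightarrow> y \<bullet> (A *v y) \<le> u \<bullet> (A *v u)"
  shows "A *v u = (u \<bullet> (A *v u)) *\<^sub>R u"
proof -
  define M where "M = u \<bullet> (A *v u)"
  define B where "B = M *\<^sub>R mat 1 - A"
  have Bv: "B *v x = M *\<^sub>R x - A *v x" for x
    by (simp add: B_def matrix_vector_mult_diff_rdistrib scaleR_matrix_vector)
  have "herm B"
    using \<open>herm A\<close> by (simp add: herm_def B_def cadj_diff cadj_scaleR)
  moreover have "\<forall>x\<in>V. 0 \<le> x \<bullet> (B *v x)"
  proof
    fix x assume "x \<in> V"
    show "0 \<le> x \<bullet> (B *v x)"
    proof (cases "x = 0")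
      case False
      have "(1 / norm x) *\<^sub>R x \<in> V"
        using V \<open>x \<in> V\<close> by (simp add: subspace_scale)
      moreover have "norm ((1 / norm x) *\<^sub>R x) = 1"
        using False by simp
      ultimately have "((1 / norm x) *\<^sub>R x) \<bullet> (A *v ((1 / norm x) *\<^sub>R x)) \<le> M"
        unfolding M_def by (rule max)
      then have "x \<bullet> (A *v x) \<le> M * (norm x)\<^sup>2"
        using False by (simp add: matrix_vector_scaleR power2_eq_square field_simps)
      then show ?thesis
        by (simp add: Bv inner_diff_right power2_norm_eq_inner)
    qed simp
  qed
  moreover have "u \<bullet> (B *v u) = 0"
    using u by (simp add: Bv inner_diff_right M_def power2_norm_eq_inner[symmetric])
  moreover have "B *v u \<in> V"
    unfolding Bv using V u inv by (intro subspace_diff subspace_scale) auto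
  ultimately have "B *v u = 0"
    using herm_psd_form_zero_imp_kernel[OF _ V _ u(1)] by blast
  then show ?thesis
    by (simp add: Bv M_def)
qed

lemma herm_eigenvector_in_range:
  fixes A Q :: "'n::finite cmat"
  assumes "herm A" "orth_proj Q" "Q \<noteq> 0" and com: "A ** Q = Q ** A"
  obtains u M where "Q *v u = u" "norm u = 1" "A *v u = M *\<^sub>R u"
proof -
  define V where "V = range ((*v) Q)"
  have V: "subspace V"
    unfolding V_def by (rule linear_subspace_image) auto
  have fix_V: "Q *v x = x" if "x \<in> V" for x
    using that \<open>orth_proj Q\<close> by (auto simp: V_def orth_proj_def matrix_vector_mul_assoc)
  have "A *v x \<in> V" if "x \<in> V" for x
    using fix_V[OF that] com unfolding V_def by (metis matrix_vector_mul_assoc rangeI)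
  moreover have "V \<noteq> {0}"
    using \<open>Q \<noteq> 0\<close> matrix_eq[of Q 0] by (auto simp: V_def)
  ultimately show ?thesis
    using rayleigh_maximizer_exists[OF V, of A] rayleigh_maximizer_eigenvector[OF \<open>herm A\<close> V]
      fix_V that by metis
qed

lemma dim_range_less:
  fixes X Y :: "'n::finite cmat"
  assumes "X ** Y = Y" "u \<in> range ((*v) X)" "u \<notin> range ((*v) Y)"
  shows "dim (range ((*v) Y)) < dim (range ((*v) X))"
proof -
  have "range ((*v) Y) \<subseteq> range ((*v) X)"
    using assms(1) by (auto simp: image_iff) (metis matrix_vector_mul_assoc)
  with assms(2,3) have "range ((*v) Y) \<subset> range ((*v) X)"
    by blast
  moreover have "span (range ((*v) M)) = range ((*v) M)" for M :: "'n cmat"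
    by (simp add: linear_subspace_image)
  ultimately show ?thesis
    by (metis eucl.dim_psubset)
qed

lemma eigenvector_deflation:
  fixes A Q :: "'n::finite cmat"
  assumes "herm A" "orth_proj Q" "A ** Q = Q ** A"
    and u: "Q *v u = u" "norm u = 1" "A *v u = M *\<^sub>R u"
  defines "Q' \<equiv> Q - rank_one u"
  shows "orth_proj Q'" "A ** Q' = Q' ** A" "Q' ** rank_one u = 0"
    "dim (range ((*v) Q')) < dim (range ((*v) Q))"
proof -
  define R where "R = rank_one u"
  have R: "orth_proj R"
    using u by (simp add: R_def orth_proj_rank_one)
  have QR: "Q ** R = R"
    using eigenvector_rank_one[of Q u 1] u by (simp add: R_def)
  have AR: "A ** R = M *\<^sub>R R"
    using eigenvector_rank_one[OF u(3)] by (simp add: R_def)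
  then have RA: "R ** A = M *\<^sub>R R"
    using herm_mult_flip[OF \<open>herm A\<close> orth_proj_herm[OF R]] R
    by (simp add: cadj_scaleR orth_proj_def)
  show Q': "orth_proj Q'"
    unfolding Q'_def R_def[symmetric] using assms(2) R QR by (rule orth_proj_diff)
  show "A ** Q' = Q' ** A"
    using assms(3) AR RA by (simp add: Q'_def R_def[symmetric] matrix_diff_ldistrib matrix_diff_rdistrib)
  show "Q' ** rank_one u = 0"
    using R QR by (simp add: Q'_def R_def[symmetric] matrix_diff_rdistrib orth_proj_def)
  have "u \<notin> range ((*v) Q')"
  proof
    assume "u \<in> range ((*v) Q')"
    then have "Q' *v u = u"
      using Q' by (auto simp: orth_proj_def matrix_vector_mul_assoc)
    moreover have "Q' *v u = 0"
      using u by (simp add: Q'_def matrix_vector_mult_diff_rdistrib rank_one_unit_vector)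
    ultimately show False
      using u by simp
  qed
  moreover have "Q ** Q' = Q'"
    using assms(2) QR by (simp add: Q'_def R_def[symmetric] matrix_diff_ldistrib orth_proj_def)
  ultimately show "dim (range ((*v) Q')) < dim (range ((*v) Q))"
    using u by (intro dim_range_less) (auto simp: image_iff intro: exI[of _ u])
qed

lemma herm_spectral_on_range:
  fixes A Q :: "'n::finite cmat"
  assumes "herm A" "orth_proj Q" "A ** Q = Q ** A"
  shows "\<exists>K P c. orth_projs K P \<and> (\<forall>k\<in>K. P k \<noteq> 0) \<and> sum P K = Q \<and>
    (\<Sum>k\<in>K. c k *\<^sub>R P k) = A ** Q"
  using assms(2,3)
proof (induction "dim (range ((*v) Q))" arbitrary: Q rule: less_induct)
  case less
  show ?case
  proof (cases "Q = 0")
    case True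
    then show ?thesis
      by (intro exI[of _ "{}"]) (simp add: orth_projs_def)
  next
    case False
    obtain u M where u: "Q *v u = u" "norm u = 1" "A *v u = M *\<^sub>R u"
      using herm_eigenvector_in_range[OF \<open>herm A\<close> less.prems(1) False less.prems(2)] .
    define R where "R = rank_one u"
    note deflation = eigenvector_deflation[OF \<open>herm A\<close> less.prems u, folded R_def]
    obtain K P c where P: "orth_projs K P" "\<forall>k\<in>K. P k \<noteq> 0" "sum P K = Q - R"
      and c: "(\<Sum>k\<in>K. c k *\<^sub>R P k) = A ** (Q - R)"
      using less.hyps[OF deflation(4,1,2)] by blast
    obtain k0 where k0: "k0 \<notin> K"
      using P(1) ex_new_if_finite[OF infinite_UNIV_nat] by (metis orth_projs_def)
    have "finite K"
      using P(1) by (simp add: orth_projs_def)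
    have "A ** R = M *\<^sub>R R"
      using eigenvector_rank_one[OF u(3)] by (simp add: R_def)
    have "(\<lambda>k. (c(k0 := M)) k *\<^sub>R (P(k0 := R)) k) = (\<lambda>k. c k *\<^sub>R P k)(k0 := M *\<^sub>R R)"
      by auto
    then have "(\<Sum>k\<in>insert k0 K. (c(k0 := M)) k *\<^sub>R (P(k0 := R)) k) = M *\<^sub>R R + (\<Sum>k\<in>K. c k *\<^sub>R P k)"
      using sum_fun_upd_insert[OF \<open>finite K\<close> k0] by metis
    also have "\<dots> = A ** Q"
      using c \<open>A ** R = M *\<^sub>R R\<close> by (simp add: matrix_diff_ldistrib)
    finally have "(\<Sum>k\<in>insert k0 K. (c(k0 := M)) k *\<^sub>R (P(k0 := R)) k) = A ** Q" .
    moreover have "sum (P(k0 := R)) (insert k0 K) = Q"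
      using sum_fun_upd_insert[OF \<open>finite K\<close> k0, of P R] P(3) by simp
    moreover have "R \<noteq> 0"
      using rank_one_unit_vector[OF u(2)] u(2) by (auto simp: R_def)
    ultimately show ?thesis
      using orth_projs_insert[OF P(1) k0 orth_proj_rank_one[OF u(2), folded R_def]] P(2,3)
        deflation(3)
      by (intro exI[of _ "insert k0 K"] exI[of _ "P(k0 := R)"] exI[of _ "c(k0 := M)"]) simp
  qed
qed

lemma pos_spectral:
  fixes X :: "'n::finite cmat"
  assumes "pos X"
  obtains K P c where "orth_projs K P" "sum P K = mat 1" "(\<Sum>k\<in>K. c k *\<^sub>R P k) = X"
    "\<forall>k\<in>K. 0 \<le> c k"
proof -
  obtain K P c where P: "orth_projs K P" "\<forall>k\<in>K. P k \<noteq> 0" "sum P K = mat 1"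
    and c: "(\<Sum>k\<in>K. c k *\<^sub>R P k) = X"
    using herm_spectral_on_range[of X "mat 1"] assms
    by (auto simp: pos_def orth_proj_mat)
  have "0 \<le> c k" if k: "k \<in> K" for k
  proof -
    obtain v where "P k *v v \<noteq> 0"
      using P(2) k matrix_eq[of "P k" 0] by force
    define w where "w = P k *v v"
    have "X ** P k = c k *\<^sub>R P k"
      using orth_projs_weighted_sum_mult[OF P(1) k, of c] c by simp
    then have "w \<bullet> (X *v w) = c k * (w \<bullet> w)"
      by (simp add: w_def matrix_vector_mul_assoc scaleR_matrix_vector)
    moreover have "0 \<le> w \<bullet> (X *v w)"
      using assms by (simp add: pos_iff_inner)
    moreover have "0 < w \<bullet> w"
      using \<open>P k *v v \<noteq> 0\<close> by (simp add: w_def)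
    ultimately show ?thesis
      by (simp add: zero_le_mult_iff)
  qed
  then show ?thesis
    using P c that by blast
qed

section \<open>Positivity\<close>

lemma Re_ctrace_orth_proj:
  assumes "orth_proj P"
  shows "Re (ctrace (X ** P)) = (\<Sum>i\<in>UNIV. column i P \<bullet> (X *v column i P))"
proof -
  have cnj_P: "cnj (P $ j $ i) = P $ i $ j" for i j
    using assms unfolding orth_proj_def by (metis cadj_nth)
  have "ctrace (X ** P) = ctrace (P ** (X ** P))"
    using assms by (simp add: orth_proj_def matrix_mul_assoc ctrace_commute[of _ P])
  also have "\<dots> = (\<Sum>i\<in>UNIV. cinner (column i P) (X *v column i P))"
    by (simp add: ctrace_def matrix_matrix_mult_def cinner_def matrix_vector_mult_def column_def cnj_P)
  finally show ?thesis
    by (simp add: inner_eq_Re_cinner)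
qed

lemma pos_orth_proj_trace_nonneg: "pos X \<Longrightarrow> orth_proj P \<Longrightarrow> 0 \<le> Re (ctrace (X ** P))"
  by (simp add: Re_ctrace_orth_proj pos_iff_inner sum_nonneg)

lemma pos_orth_proj_trace_eq_0:
  assumes X: "pos X" and "orth_proj P" and "Re (ctrace (X ** P)) = 0"
  shows "X ** P = 0"
proof -
  have "\<forall>i\<in>UNIV. column i P \<bullet> (X *v column i P) = 0"
    using assms sum_nonneg_eq_0_iff[of UNIV "\<lambda>i. column i P \<bullet> (X *v column i P)"]
    by (simp add: Re_ctrace_orth_proj pos_iff_inner)
  then have "X *v column i P = 0" for i
    using X by (intro herm_psd_form_zero_imp_kernel[OF _ subspace_UNIV]) (auto simp: pos_iff_inner)
  then show ?thesis
    by (simp add: vec_eq_iff matrix_matrix_mult_def matrix_vector_mult_def column_def)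
qed

lemma hs_inner_pos_nonneg:
  assumes "pos X" and "pos \<rho>"
  shows "0 \<le> Re (hs_inner X \<rho>)"
proof -
  obtain K P c where P: "orth_projs K P" and c: "(\<Sum>k\<in>K. c k *\<^sub>R P k) = \<rho>" "\<forall>k\<in>K. 0 \<le> c k"
    using pos_spectral[OF \<open>pos \<rho>\<close>] by metis
  have "Re (hs_inner X \<rho>) = (\<Sum>k\<in>K. c k * Re (ctrace (X ** P k)))"
    using \<open>pos X\<close> by (simp add: hs_inner_herm pos_def c(1)[symmetric] matrix_sum_ldistrib
        matrix_mul_scaleR_right ctrace_sum ctrace_scaleR)
  also have "0 \<le> \<dots>"
    using assms P c(2) by (intro sum_nonneg mult_nonneg_nonneg pos_orth_proj_trace_nonneg)
      (auto simp: orth_projs_def)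
  finally show ?thesis .
qed

lemma hs_inner_orth_proj_eq_0:
  assumes "orth_proj P" "pos \<rho>" "Re (hs_inner P \<rho>) = 0"
  shows "\<rho> ** P = 0" "P ** \<rho> = 0"
proof -
  show "\<rho> ** P = 0"
    using assms by (intro pos_orth_proj_trace_eq_0)
      (simp_all add: hs_inner_herm orth_proj_herm ctrace_commute[of P])
  then show "P ** \<rho> = 0"
    using herm_mult_flip assms orth_proj_herm pos_def by fastforce
qed

lemma pos_sum: "(\<And>k. k \<in> K \<Longrightarrow> pos (f k)) \<Longrightarrow> pos (sum f K)"
proof (induction K rule: infinite_finite_induct)
  case (insert k K)
  then show ?case
    by (simp add: pos_iff_inner herm_def cadj_add matrix_vector_mult_add_rdistrib inner_add_right)
qed (simp_all add: pos_iff_inner herm_def)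

lemma dens_maximally_mixed: "dens ((1 / real CARD('n)) *\<^sub>R mat 1 :: 'n::finite cmat)"
  by (simp add: dens_def pos_iff_inner herm_def cadj_scaleR scaleR_matrix_vector ctrace_scaleR
      ctrace_mat)

lemma hs_inner_maximally_mixed_pos:
  assumes "pos X" "X \<noteq> 0"
  shows "0 < Re (hs_inner X ((1 / real CARD('n)) *\<^sub>R mat 1 :: 'n::finite cmat))"
proof -
  have "Re (ctrace X) \<noteq> 0"
    using pos_orth_proj_trace_eq_0[OF \<open>pos X\<close> orth_proj_mat] assms(2) by auto
  then have "0 < Re (ctrace X)"
    using pos_orth_proj_trace_nonneg[OF \<open>pos X\<close> orth_proj_mat] by simp
  then show ?thesis
    using \<open>pos X\<close> by (simp add: hs_inner_herm pos_def matrix_mul_scaleR_right ctrace_scaleR)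
qed

lemma pos_support_projection:
  assumes "pos B"
  obtains P where "orth_proj P" "\<And>\<rho>. pos \<rho> \<Longrightarrow> Re (hs_inner B \<rho>) = 0 \<longleftrightarrow> Re (hs_inner P \<rho>) = 0"
proof -
  obtain K Q c where Q: "orth_projs K Q" and c: "(\<Sum>k\<in>K. c k *\<^sub>R Q k) = B" "\<forall>k\<in>K. 0 \<le> c k"
    using pos_spectral[OF assms] by metis
  define K' where "K' = {k\<in>K. c k \<noteq> 0}"
  have Q': "orth_projs K' Q"
    using Q by (auto simp: orth_projs_def K'_def)
  have "Re (hs_inner B \<rho>) = 0 \<longleftrightarrow> Re (hs_inner (sum Q K') \<rho>) = 0" if "pos \<rho>" for \<rho>
  proof -
    define t where "t k = Re (hs_inner (Q k) \<rho>)" for k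
    have t: "0 \<le> t k" if "k \<in> K" for k
      using that Q \<open>pos \<rho>\<close> by (simp add: t_def orth_projs_def hs_inner_pos_nonneg orth_proj_pos)
    have "Re (hs_inner B \<rho>) = (\<Sum>k\<in>K. c k * t k)"
      by (simp add: c(1)[symmetric] t_def hs_inner_sum_left hs_inner_scaleR_left)
    also have "\<dots> = (\<Sum>k\<in>K'. c k * t k)"
      using Q by (intro sum.mono_neutral_right) (auto simp: K'_def orth_projs_def)
    finally have B: "Re (hs_inner B \<rho>) = (\<Sum>k\<in>K'. c k * t k)" .
    have "finite K'" "\<forall>k\<in>K'. 0 \<le> c k * t k"
      using Q' t c(2) by (simp_all add: orth_projs_def K'_def)
    then have "Re (hs_inner B \<rho>) = 0 \<longleftrightarrow> (\<forall>k\<in>K'. c k * t k = 0)"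
      by (simp add: B sum_nonneg_eq_0_iff)
    also have "\<dots> \<longleftrightarrow> (\<forall>k\<in>K'. t k = 0)"
      by (simp add: K'_def)
    also have "\<dots> \<longleftrightarrow> sum t K' = 0"
      using \<open>finite K'\<close> t by (intro sum_nonneg_eq_0_iff[symmetric]) (auto simp: K'_def)
    also have "sum t K' = Re (hs_inner (sum Q K') \<rho>)"
      by (simp add: t_def hs_inner_sum_left)
    finally show ?thesis .
  qed
  then show ?thesis
    using orth_projs_sum[OF Q'] that by blast
qed

section \<open>Scores\<close>

lemma ereal_sum_eq_infinite_term:
  fixes f :: "'a \<Rightarrow> ereal"
  assumes "finite Y" "y \<in> Y" "\<bar>f y\<bar> = \<infinity>" "\<forall>z\<in>Y. f z \<noteq> - f y"
  shows "sum f Y = f y"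
  using assms
proof (induction Y rule: finite_induct)
  case (insert x F)
  then show ?case
    by (cases "x = y"; cases "y \<in> F") (auto simp: sum_Pinfty)
qed simp

definition outcome_score :: "(nat \<Rightarrow> 'n::finite cmat) \<Rightarrow> (nat \<Rightarrow> ereal) \<Rightarrow> 'n cmat \<Rightarrow> nat \<Rightarrow> ereal" where
  "outcome_score m s \<rho> y = ereal (Re (hs_inner (m y) \<rho>)) * s y"

definition scores_well_defined :: "nat set \<Rightarrow> (nat \<Rightarrow> 'n::finite cmat) \<Rightarrow> (nat \<Rightarrow> ereal) \<Rightarrow> bool" where
  "scores_well_defined Y m s \<longleftrightarrow> (\<forall>\<rho>. dens \<rho> \<longrightarrow>
     \<not> ((\<exists>y\<in>Y. outcome_score m s \<rho> y = \<infinity>) \<and> (\<exists>y\<in>Y. outcome_score m s \<rho> y = -\<infinity>)))"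

definition infinite_outcomes :: "nat set \<Rightarrow> (nat \<Rightarrow> 'n::finite cmat) \<Rightarrow> (nat \<Rightarrow> ereal) \<Rightarrow> nat set" where
  "infinite_outcomes Y \<mu> s = {y\<in>Y. \<mu> y \<noteq> 0 \<and> \<bar>s y\<bar> = \<infinity>}"

text \<open>Infinite scores drop out, since real_of_ereal maps \<plusminus>\<infinity> to 0.\<close>
definition finite_score_observable :: "nat set \<Rightarrow> (nat \<Rightarrow> 'n::finite cmat) \<Rightarrow> (nat \<Rightarrow> ereal) \<Rightarrow> 'n cmat" where
  "finite_score_observable Y \<mu> s = (\<Sum>y\<in>Y. real_of_ereal (s y) *\<^sub>R \<mu> y)"

lemma quantum_score_iff:
  "quantum_score S \<longleftrightarrow> (\<forall>\<rho>. dens \<rho> \<longrightarrow> is_measurement (fst (snd S \<rho>)) (snd (snd S \<rho>)) \<and>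
     scores_well_defined (fst (snd S \<rho>)) (snd (snd S \<rho>)) (fst S \<rho>))"
  by (auto simp: quantum_score_def score_well_defined_def scores_well_defined_def
      score_term_def outcome_score_def)

lemma expected_score_eq:
  "expected_score S \<rho>' \<rho> = (\<Sum>y\<in>fst (snd S \<rho>'). outcome_score (snd (snd S \<rho>')) (fst S \<rho>') \<rho> y)"
  by (simp add: expected_score_def score_term_def outcome_score_def)

lemma infinite_scores_agree:
  fixes \<mu> :: "nat \<Rightarrow> 'n::finite cmat"
  assumes "is_measurement Y \<mu>" and wd: "scores_well_defined Y \<mu> s"
  obtains \<sigma> where "\<bar>\<sigma>\<bar> = \<infinity>" "\<forall>y\<in>infinite_outcomes Y \<mu> s. s y = \<sigma>"
proof -
  define \<rho>0 :: "'n cmat" where "\<rho>0 = (1 / real CARD('n)) *\<^sub>R mat 1"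
  have score_\<rho>0: "outcome_score \<mu> s \<rho>0 y = s y" if "y \<in> infinite_outcomes Y \<mu> s" for y
  proof -
    have "0 < Re (hs_inner (\<mu> y) \<rho>0)"
      using that assms(1) unfolding \<rho>0_def
      by (intro hs_inner_maximally_mixed_pos) (auto simp: is_measurement_def infinite_outcomes_def)
    then show ?thesis
      using that by (cases "s y") (auto simp: outcome_score_def infinite_outcomes_def)
  qed
  have agree: "s y = s z" if "y \<in> infinite_outcomes Y \<mu> s" "z \<in> infinite_outcomes Y \<mu> s" for y z
    using wd dens_maximally_mixed score_\<rho>0[OF that(1)] score_\<rho>0[OF that(2)] that
    unfolding scores_well_defined_def \<rho>0_def
    by (cases "s y"; cases "s z") (auto simp: infinite_outcomes_def)
  show ?thesis
  proof (cases "infinite_outcomes Y \<mu> s = {}")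
    case False
    then obtain y where y: "y \<in> infinite_outcomes Y \<mu> s"
      by blast
    then have "\<bar>s y\<bar> = \<infinity>"
      by (simp add: infinite_outcomes_def)
    then show ?thesis
      using agree[OF y] by (intro that) auto
  qed (intro that[of \<infinity>], simp_all)
qed

lemma score_sum_eq_infinite_score:
  assumes "finite Y" "scores_well_defined Y \<mu> s" "dens \<rho>"
    and "y \<in> Y" "\<bar>s y\<bar> = \<infinity>" "0 < Re (hs_inner (\<mu> y) \<rho>)"
  shows "(\<Sum>z\<in>Y. outcome_score \<mu> s \<rho> z) = s y"
proof -
  have y: "outcome_score \<mu> s \<rho> y = s y"
    using assms(5,6) by (cases "s y") (auto simp: outcome_score_def)
  then have "\<forall>z\<in>Y. outcome_score \<mu> s \<rho> z \<noteq> - s y"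
    using assms(2-5) unfolding scores_well_defined_def by (cases "s y") force+
  then show ?thesis
    using ereal_sum_eq_infinite_term[OF assms(1,4)] y assms(5) by simp
qed

lemma score_sum_eq_finite_observable:
  assumes "\<forall>y\<in>infinite_outcomes Y \<mu> s. Re (hs_inner (\<mu> y) \<rho>) = 0"
  shows "(\<Sum>y\<in>Y. outcome_score \<mu> s \<rho> y) = ereal (Re (hs_inner (finite_score_observable Y \<mu> s) \<rho>))"
proof -
  have "outcome_score \<mu> s \<rho> y = ereal (Re (hs_inner (\<mu> y) \<rho>) * real_of_ereal (s y))" if "y \<in> Y" for y
  proof (cases "Re (hs_inner (\<mu> y) \<rho>) = 0")
    case False
    then have "\<mu> y \<noteq> 0"
      by (auto simp: hs_inner_def ctrace_def)
    then have "\<bar>s y\<bar> \<noteq> \<infinity>"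
      using assms that False by (auto simp: infinite_outcomes_def)
    then show ?thesis
      by (cases "s y") (auto simp: outcome_score_def)
  qed (simp add: outcome_score_def zero_ereal_def[symmetric])
  then show ?thesis
    by (simp add: finite_score_observable_def hs_inner_sum_left hs_inner_scaleR_left mult.commute)
qed

lemma score_sum_fun_upd:
  assumes "finite K" "k0 \<notin> K"
  shows "(\<Sum>k\<in>insert k0 K. outcome_score (Q(k0 := P)) ((ereal \<circ> c)(k0 := \<sigma>)) \<rho> k) =
    ereal (Re (hs_inner P \<rho>)) * \<sigma> + ereal (Re (hs_inner (\<Sum>k\<in>K. c k *\<^sub>R Q k) \<rho>))"
proof -
  have "(\<Sum>k\<in>K. outcome_score (Q(k0 := P)) ((ereal \<circ> c)(k0 := \<sigma>)) \<rho> k) =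
      (\<Sum>k\<in>K. ereal (c k * Re (hs_inner (Q k) \<rho>)))"
    using assms(2) by (intro sum.cong) (auto simp: outcome_score_def mult.commute)
  then show ?thesis
    using assms by (simp add: outcome_score_def hs_inner_sum_left hs_inner_scaleR_left)
qed

lemma measurement_score_sum_dichotomy:
  fixes \<mu> :: "nat \<Rightarrow> 'n::finite cmat"
  assumes meas: "is_measurement Y \<mu>" and wd: "scores_well_defined Y \<mu> s"
  obtains P \<sigma> where "orth_proj P" "\<bar>\<sigma>\<bar> = \<infinity>"
    "\<And>\<rho>. dens \<rho> \<Longrightarrow> Re (hs_inner P \<rho>) = 0 \<Longrightarrow>
      (\<Sum>y\<in>Y. outcome_score \<mu> s \<rho> y) = ereal (Re (hs_inner (finite_score_observable Y \<mu> s) \<rho>))"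
    "\<And>\<rho>. dens \<rho> \<Longrightarrow> Re (hs_inner P \<rho>) \<noteq> 0 \<Longrightarrow> (\<Sum>y\<in>Y. outcome_score \<mu> s \<rho> y) = \<sigma>"
proof -
  have "finite Y" and pos_\<mu>: "\<And>y. y \<in> Y \<Longrightarrow> pos (\<mu> y)"
    using meas by (auto simp: is_measurement_def)
  define Yi where "Yi = infinite_outcomes Y \<mu> s"
  have "Yi \<subseteq> Y"
    by (auto simp: Yi_def infinite_outcomes_def)
  obtain \<sigma> where \<sigma>: "\<bar>\<sigma>\<bar> = \<infinity>" "\<forall>y\<in>Yi. s y = \<sigma>"
    using infinite_scores_agree[OF meas wd] unfolding Yi_def .
  have "pos (sum \<mu> Yi)"
    using pos_\<mu> \<open>Yi \<subseteq> Y\<close> by (intro pos_sum) auto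
  then obtain P where P: "orth_proj P"
    and supp: "\<And>\<rho>. pos \<rho> \<Longrightarrow> Re (hs_inner (sum \<mu> Yi) \<rho>) = 0 \<longleftrightarrow> Re (hs_inner P \<rho>) = 0"
    using pos_support_projection by blast
  show thesis
  proof (rule that[OF P \<sigma>(1)])
    fix \<rho> :: "'n cmat"
    assume "dens \<rho>" "Re (hs_inner P \<rho>) = 0"
    then have "\<forall>y\<in>Yi. Re (hs_inner (\<mu> y) \<rho>) = 0"
      using supp \<open>finite Y\<close> \<open>Yi \<subseteq> Y\<close> pos_\<mu>
      by (subst sum_nonneg_eq_0_iff[symmetric])
        (auto simp: dens_def hs_inner_sum_left finite_subset hs_inner_pos_nonneg)
    then show "(\<Sum>y\<in>Y. outcome_score \<mu> s \<rho> y) = ereal (Re (hs_inner (finite_score_observable Y \<mu> s) \<rho>))"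
      unfolding Yi_def by (rule score_sum_eq_finite_observable)
  next
    fix \<rho> :: "'n cmat"
    assume "dens \<rho>" "Re (hs_inner P \<rho>) \<noteq> 0"
    then have "(\<Sum>y\<in>Yi. Re (hs_inner (\<mu> y) \<rho>)) \<noteq> 0"
      using supp by (simp add: dens_def hs_inner_sum_left)
    then obtain y where y: "y \<in> Yi" "Re (hs_inner (\<mu> y) \<rho>) \<noteq> 0"
      using sum.neutral[of Yi "\<lambda>y. Re (hs_inner (\<mu> y) \<rho>)"] by blast
    have "y \<in> Y" "\<bar>s y\<bar> = \<infinity>"
      using y(1) by (simp_all add: Yi_def infinite_outcomes_def)
    moreover have "s y = \<sigma>"
      using y(1) \<sigma>(2) by blast
    moreover have "0 < Re (hs_inner (\<mu> y) \<rho>)"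
      using y(2) hs_inner_pos_nonneg[OF pos_\<mu>[OF \<open>y \<in> Y\<close>]] \<open>dens \<rho>\<close>
      by (force simp: dens_def)
    ultimately show "(\<Sum>y\<in>Y. outcome_score \<mu> s \<rho> y) = \<sigma>"
      using score_sum_eq_infinite_score[OF \<open>finite Y\<close> wd \<open>dens \<rho>\<close>] by simp
  qed
qed

lemma pvm_with_compressed_spectrum:
  fixes P C :: "'n::finite cmat"
  assumes P: "orth_proj P" and "herm C"
  obtains K Q c k0 where "finite K" "k0 \<notin> K" "is_pvm (insert k0 K) (Q(k0 := P))"
    "(\<Sum>k\<in>K. c k *\<^sub>R Q k) = (mat 1 - P) ** C ** (mat 1 - P)"
proof -
  define Z where "Z = mat 1 - P"
  have Z: "orth_proj Z" "Z ** P = 0"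
    using orth_proj_diff[OF orth_proj_mat P] P by (simp_all add: Z_def matrix_diff_rdistrib orth_proj_def)
  have "herm (Z ** C ** Z)"
    using \<open>herm C\<close> Z(1) by (simp add: herm_def orth_proj_def cadj_mult matrix_mul_assoc)
  moreover have ZCZ: "(Z ** C ** Z) ** Z = Z ** C ** Z" "Z ** (Z ** C ** Z) = Z ** C ** Z"
    using Z(1) unfolding orth_proj_def by (metis matrix_mul_assoc)+
  ultimately obtain K Q c where Q: "orth_projs K Q" "sum Q K = Z" "(\<Sum>k\<in>K. c k *\<^sub>R Q k) = Z ** C ** Z"
    using herm_spectral_on_range[of "Z ** C ** Z" Z] Z(1) by (auto simp only: ZCZ)
  obtain k0 where k0: "k0 \<notin> K"
    using Q(1) ex_new_if_finite[OF infinite_UNIV_nat] by (metis orth_projs_def)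
  have "finite K"
    using Q(1) by (simp add: orth_projs_def)
  have "sum (Q(k0 := P)) (insert k0 K) = mat 1"
    using Q(2) sum_fun_upd_insert[OF \<open>finite K\<close> k0, of Q P] by (simp add: Z_def)
  then have "is_pvm (insert k0 K) (Q(k0 := P))"
    using orth_projs_insert[OF Q(1) k0 P] Q(2) Z(2) by (simp add: pvm_iff_orth_projs)
  then show thesis
    using that \<open>finite K\<close> k0 Q(3) by (simp add: Z_def)
qed

lemma measurement_scores_refine_to_pvm:
  fixes \<mu> :: "nat \<Rightarrow> 'n::finite cmat"
  assumes "is_measurement Y \<mu>" "scores_well_defined Y \<mu> s"
  obtains Y' m s' where "is_pvm Y' m" "scores_well_defined Y' m s'"
    "\<And>\<rho>. dens \<rho> \<Longrightarrow> (\<Sum>y\<in>Y'. outcome_score m s' \<rho> y) = (\<Sum>y\<in>Y. outcome_score \<mu> s \<rho> y)"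
proof -
  obtain P \<sigma> where P: "orth_proj P" "\<bar>\<sigma>\<bar> = \<infinity>"
    and off_P: "\<And>\<rho>. dens \<rho> \<Longrightarrow> Re (hs_inner P \<rho>) = 0 \<Longrightarrow>
      (\<Sum>y\<in>Y. outcome_score \<mu> s \<rho> y) = ereal (Re (hs_inner (finite_score_observable Y \<mu> s) \<rho>))"
    and on_P: "\<And>\<rho>. dens \<rho> \<Longrightarrow> Re (hs_inner P \<rho>) \<noteq> 0 \<Longrightarrow> (\<Sum>y\<in>Y. outcome_score \<mu> s \<rho> y) = \<sigma>"
    using measurement_score_sum_dichotomy[OF assms] by blast
  define Z where "Z = mat 1 - P"
  define C where "C = finite_score_observable Y \<mu> s"
  have "herm Z"
    using orth_proj_herm[OF orth_proj_diff[OF orth_proj_mat P(1)]] by (simp add: Z_def)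
  have "herm C"
    using assms(1) unfolding is_measurement_def
    by (simp add: C_def finite_score_observable_def herm_def pos_def cadj_sum cadj_scaleR)
  obtain K Q c k0 where K: "finite K" "k0 \<notin> K" and pvm: "is_pvm (insert k0 K) (Q(k0 := P))"
    and c: "(\<Sum>k\<in>K. c k *\<^sub>R Q k) = Z ** C ** Z"
    by (rule pvm_with_compressed_spectrum[OF P(1) \<open>herm C\<close>, folded Z_def])
  define s' where "s' = (ereal \<circ> c)(k0 := \<sigma>)"
  have "scores_well_defined (insert k0 K) (Q(k0 := P)) s'"
    using K by (auto simp: scores_well_defined_def outcome_score_def s'_def)
  moreover have "(\<Sum>y\<in>insert k0 K. outcome_score (Q(k0 := P)) s' \<rho> y) = (\<Sum>y\<in>Y. outcome_score \<mu> s \<rho> y)"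
    if "dens \<rho>" for \<rho>
  proof -
    have new: "(\<Sum>y\<in>insert k0 K. outcome_score (Q(k0 := P)) s' \<rho> y) =
        ereal (Re (hs_inner P \<rho>)) * \<sigma> + ereal (Re (hs_inner (Z ** C ** Z) \<rho>))"
      using score_sum_fun_upd[OF K, of Q P c \<sigma> \<rho>] c by (simp add: s'_def)
    show ?thesis
    proof (cases "Re (hs_inner P \<rho>) = 0")
      case True
      then have "Z ** \<rho> = \<rho>" "\<rho> ** Z = \<rho>"
        using hs_inner_orth_proj_eq_0[OF P(1)] that
        by (simp_all add: dens_def Z_def matrix_diff_ldistrib matrix_diff_rdistrib)
      then show ?thesis
        using new True off_P[OF that] hs_inner_compression[OF \<open>herm Z\<close>]
        by (simp add: C_def zero_ereal_def[symmetric])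
    next
      case False
      then have "0 < Re (hs_inner P \<rho>)"
        using hs_inner_pos_nonneg[OF orth_proj_pos[OF P(1)]] that by (force simp: dens_def)
      then show ?thesis
        using new on_P[OF that False] P(2) by (cases \<sigma>) auto
    qed
  qed
  ultimately show thesis
    by (rule that[OF pvm])
qed

theorem proposition3p5:
  fixes S :: "'n::finite qscore"
  assumes "quantum_score S"
  shows "\<exists>S' :: 'n qscore. quantum_score S' \<and> projective S' \<and>
           (\<forall>\<rho>' \<rho>. dens \<rho>' \<longrightarrow> dens \<rho> \<longrightarrow> expected_score S' \<rho>' \<rho> = expected_score S \<rho>' \<rho>)"
proof -
  have "\<exists>Y' m s'. dens \<rho>' \<longrightarrow> is_pvm Y' m \<and> scores_well_defined Y' m s' \<and>
      (\<forall>\<rho>. dens \<rho> \<longrightarrow> (\<Sum>y\<in>Y'. outcome_score m s' \<rho> y) = expected_score S \<rho>' \<rho>)" for \<rho>'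
    using assms measurement_scores_refine_to_pvm unfolding quantum_score_iff expected_score_eq
    by metis
  then obtain Y' m s' where refine: "\<And>\<rho>'. dens \<rho>' \<Longrightarrow>
      is_pvm (Y' \<rho>') (m \<rho>') \<and> scores_well_defined (Y' \<rho>') (m \<rho>') (s' \<rho>') \<and>
      (\<forall>\<rho>. dens \<rho> \<longrightarrow> (\<Sum>y\<in>Y' \<rho>'. outcome_score (m \<rho>') (s' \<rho>') \<rho> y) = expected_score S \<rho>' \<rho>)"
    by metis
  define S' :: "'n qscore" where "S' = (s', \<lambda>\<rho>'. (Y' \<rho>', m \<rho>'))"
  have "quantum_score S'" "projective S'"
    using refine by (auto simp: quantum_score_iff projective_def S'_def is_pvm_def)
  moreover have "expected_score S' \<rho>' \<rho> = expected_score S \<rho>' \<rho>" if "dens \<rho>'" "dens \<rho>" for \<rho>' \<rho>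
    using refine that by (simp add: expected_score_eq S'_def)
  ultimately show ?thesis
    by blast
qed

end
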